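(* For any integer $m\ge2$, let $\Theta_m$ be the set of all $\theta\in\mathbb{N}$ such that for every ranking pattern $\boldsymbol{\sigma}\in\Sigma^{(m)}$ there exists a voting situation $\mathcal{N}^{(m)}$ that is $q$-concordant with $\boldsymbol{\sigma}$ and has total number of voters $n(\mathcal{N}^{(m)})=\theta$. Then: (i) $\Theta_m$ is non-empty; (ii) any $\theta\in\Theta_m$ is a multiple of $\operatorname{lcm}\{2,\ldots,m\}$; (iii) if $\theta\in\Theta_m$ then $\theta+m!\in\Theta_m$.
   Context: $\mathbb{N}=\{1,2,\ldots\}$. Let $[k]=\{1,\dots,k\}$ (with $[0]=\emptyset$), $[m]$ the set of candidates, and $\Pi_m$ the set of permutations $(j_1,\ldots,j_m)$ of the elements of $[m]$. Ranking functions and patterns. For $A\subseteq[m]$, a map $\sigma(A,\cdot):A\to\{1,\ldots,|A|\}$ is a ranking function if for each $i\in A$, $\sigma(A,i)=1+\left|\{j\in A:\sigma(A,j)\le\sigma(A,i)-1\}\right|$ (ties are allowed). A ranking pattern over $[m]$ ($m\ge2$) is a family $\boldsymbol{\sigma}=\{\sigma(A,\cdot):A\subseteq[m],\,|A|\ge2\}$ of ranking functions. $\Sigma^{(m)}$ denotes the set of all ranking patterns over $[m]$. Voting situations. A voting situation is a family $\mathcal{N}^{(m)}=\{N^{(m)}(j_1,\ldots,j_m):(j_1,\ldots,j_m)\in\Pi_m\}$ of non-negative integers, where $N^{(m)}(j_1,\ldots,j_m)$ is the number of voters (in a finite nonempty set of voters) whose preference ranking, from most to least preferred, is $(j_1,\ldots,j_m)$.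 The total number of voters is $n(\mathcal{N}^{(m)})=\sum_{(j_1,\ldots,j_m)\in\Pi_m}N^{(m)}(j_1,\ldots,j_m)$. For $A\subseteq[m]$ and $i\in A$, $n_i(A)$ is the number of votes obtained by $i$ when $A$ is the set of competing candidates, i.e. the sum of $N^{(m)}(j_1,\ldots,j_m)$ over all $(j_1,\ldots,j_m)\in\Pi_m$ in which $i$ occupies an earlier position than every other element of $A$. Concordance. $\boldsymbol{\sigma}$ and $\mathcal{N}^{(m)}$ are $q$-concordant if for any $A\subseteq[m]$ and $i,j\in A$ with $i\ne j$: $\sigma(A,i)<\sigma(A,j)\Leftrightarrow n_i(A)>n_j(A)$, and $\sigma(A,i)=\sigma(A,j)\Leftrightarrow n_i(A)=n_j(A)$. *)

theory Defs
  imports Complex_Main "HOL-Combinatorics.Multiset_Permutations"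
begin

(* Since r i is at least 1 for i in A, the truncated subtraction r i - 1 is exact. *)
definition ranking_function :: "nat set \<Rightarrow> (nat \<Rightarrow> nat) \<Rightarrow> bool" where
  "ranking_function A r \<longleftrightarrow>
     (\<forall>i\<in>A. r i \<in> {1..card A}) \<and>
     (\<forall>i\<in>A. r i = 1 + card {j \<in> A. r j \<le> r i - 1})"

(* The family is a total function; its values at other sets A, or at i outside A, are
   arbitrary and never used. *)
definition ranking_pattern :: "nat \<Rightarrow> (nat set \<Rightarrow> nat \<Rightarrow> nat) \<Rightarrow> bool" where
  "ranking_pattern m \<sigma> \<longleftrightarrow> (\<forall>A. A \<subseteq> {1..m} \<and> card A \<ge> 2 \<longrightarrow> ranking_function A (\<sigma> A))"

(* A preference ranking is a list containing each candidate in {1..m} exactly once, most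
   preferred first. N js is the number of voters with ranking js; the values of N at lists
   that are not such rankings are arbitrary and never used. *)
definition total_voters :: "nat \<Rightarrow> (nat list \<Rightarrow> nat) \<Rightarrow> nat" where
  "total_voters m N = (\<Sum>js\<in>permutations_of_set {1..m}. N js)"

(* The set of voters is nonempty. *)
definition voting_situation :: "nat \<Rightarrow> (nat list \<Rightarrow> nat) \<Rightarrow> bool" where
  "voting_situation m N \<longleftrightarrow> total_voters m N > 0"

definition precedes :: "nat list \<Rightarrow> nat \<Rightarrow> nat \<Rightarrow> bool" where
  "precedes js i j \<longleftrightarrow> (\<exists>p q. p < q \<and> q < length js \<and> js ! p = i \<and> js ! q = j)"

definition votes :: "nat \<Rightarrow> (nat list \<Rightarrow> nat) \<Rightarrow> nat set \<Rightarrow> nat \<Rightarrow> nat" where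
  "votes m N A i =
     (\<Sum>js\<in>{js \<in> permutations_of_set {1..m}. \<forall>j\<in>A - {i}. precedes js i j}. N js)"

definition q_concordant :: "nat \<Rightarrow> (nat set \<Rightarrow> nat \<Rightarrow> nat) \<Rightarrow> (nat list \<Rightarrow> nat) \<Rightarrow> bool" where
  "q_concordant m \<sigma> N \<longleftrightarrow>
     (\<forall>A i j. A \<subseteq> {1..m} \<and> i \<in> A \<and> j \<in> A \<and> i \<noteq> j \<longrightarrow>
        (\<sigma> A i < \<sigma> A j \<longleftrightarrow> votes m N A i > votes m N A j) \<and>
        (\<sigma> A i = \<sigma> A j \<longleftrightarrow> votes m N A i = votes m N A j))"

definition Theta :: "nat \<Rightarrow> nat set" where
  "Theta m = {\<theta>. \<theta> \<ge> 1 \<and>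
     (\<forall>\<sigma>. ranking_pattern m \<sigma> \<longrightarrow>
        (\<exists>N. voting_situation m N \<and> q_concordant m \<sigma> N \<and> total_voters m N = \<theta>))}"

end

theory Submission
  imports Defs
begin

text \<open>
  Fix a set \<open>A\<close> of at least two candidates and \<open>a \<noteq> b\<close> in \<open>A\<close>. Take a ranking that lists the
  candidates outside \<open>A\<close> first, then \<open>a\<close>, \<open>b\<close> and the rest of \<open>A\<close>, and subtract from it the
  ranking obtained by exchanging \<open>a\<close> and \<open>b\<close>. This signed profile moves one vote from \<open>b\<close> to \<open>a\<close>
  exactly in the elections \<open>B \<subseteq> A\<close> containing both, so by induction on \<open>A\<close> there is an integer
  profile that moves one vote from \<open>b\<close> to \<open>a\<close> in the election \<open>A\<close> and changes no other election.
  Integer combinations of these profiles realise every ranking pattern with coefficients bounded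
  in terms of \<open>m\<close>. Adding one voter for each of the \<open>m!\<close> rankings changes no difference of votes,
  so a large multiple of this uniform profile makes everything nonnegative, with the same total
  for all patterns; the same addition gives (iii). For (ii), apply the hypothesis to the pattern
  in which all candidates are tied.
\<close>

section \<open>Signed profiles and their vote counts\<close>

text \<open>A ranking votes for the first of its entries that competes. With \<open>find\<close>,
  the vote becomes a partial function of the ranking, convenient for induction on lists and for
  counting.\<close>

lemma all_precedes_iff_find:
  assumes "distinct js" "A \<subseteq> set js" "i \<in> A"
  shows "(\<forall>j\<in>A - {i}. precedes js i j) \<longleftrightarrow> find (\<lambda>x. x \<in> A) js = Some i"
proof
  assume L: "\<forall>j\<in>A - {i}. precedes js i j"
  obtain k where k: "k < length js" "js ! k = i"
    using assms by (meson in_set_conv_nth subsetD)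
  have "js ! l \<notin> A" if "l < k" for l
  proof
    assume "js ! l \<in> A"
    moreover have "js ! l \<noteq> i"
      using assms(1) k that by (metis less_trans nat_neq_iff nth_eq_iff_index_eq)
    ultimately obtain p q where pq: "p < q" "q < length js" "js ! p = i" "js ! q = js ! l"
      using L unfolding precedes_def by blast
    \<comment> \<open>Since entries are distinct, the positions witnessing \<open>precedes\<close>
      must be \<open>k\<close> and \<open>l\<close>, so \<open>p < q\<close> contradicts
      \<open>l < k\<close>.\<close>
    then have "p = k" "q = l"
      using nth_eq_iff_index_eq[OF assms(1), of p k] nth_eq_iff_index_eq[OF assms(1), of q l] k that
      by simp_all
    then show False
      using pq that by simp
  qed
  then show "find (\<lambda>x. x \<in> A) js = Some i"
    using k assms(3) unfolding find_Some_iff by blast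
next
  assume "find (\<lambda>x. x \<in> A) js = Some i"
  then obtain k where k: "k < length js" "js ! k = i" "\<And>l. l < k \<Longrightarrow> js ! l \<notin> A"
    unfolding find_Some_iff by blast
  show "\<forall>j\<in>A - {i}. precedes js i j"
  proof
    fix j assume j: "j \<in> A - {i}"
    then obtain q where q: "q < length js" "js ! q = j"
      using assms by (meson DiffD1 in_set_conv_nth subsetD)
    then have "k < q"
      using k j by (metis DiffD1 DiffD2 insertCI linorder_neqE_nat)
    then show "precedes js i j"
      unfolding precedes_def using k q by blast
  qed
qed

text \<open>Integer weights allow profiles to be subtracted, so that votes are linear in the
  profile. A candidate outside \<open>A\<close> gets 0, because \<open>find\<close> returns only
  members of \<open>A\<close>.\<close>

definition signed_votes :: "nat \<Rightarrow> (nat list \<Rightarrow> int) \<Rightarrow> nat set \<Rightarrow> nat \<Rightarrow> int" where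
  "signed_votes m w A i =
     (\<Sum>js\<in>permutations_of_set {1..m}. w js * of_bool (find (\<lambda>x. x \<in> A) js = Some i))"

lemma votes_eq_signed_votes:
  assumes "A \<subseteq> {1..m}" "i \<in> A"
  shows "int (votes m N A i) = signed_votes m (\<lambda>js. int (N js)) A i"
proof -
  have "{js \<in> permutations_of_set {1..m}. \<forall>j\<in>A - {i}. precedes js i j} =
        {js \<in> permutations_of_set {1..m}. find (\<lambda>x. x \<in> A) js = Some i}"
    using all_precedes_iff_find[OF _ _ assms(2)] assms(1)
    by (auto simp: permutations_of_set_def)
  then show ?thesis
    unfolding votes_def signed_votes_def
    by (simp add: of_bool_def if_distrib sum.If_cases Int_def cong: if_cong)
qed

lemma signed_votes_add:
  "signed_votes m (\<lambda>js. v js + w js) A i = signed_votes m v A i + signed_votes m w A i"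
  by (simp add: signed_votes_def distrib_right sum.distrib)

lemma signed_votes_diff:
  "signed_votes m (\<lambda>js. v js - w js) A i = signed_votes m v A i - signed_votes m w A i"
  by (simp add: signed_votes_def left_diff_distrib sum_subtractf)

lemma signed_votes_scale:
  "signed_votes m (\<lambda>js. c * w js) A i = c * signed_votes m w A i"
  unfolding signed_votes_def sum_distrib_left mult.assoc ..

lemma signed_votes_sum:
  "signed_votes m (\<lambda>js. \<Sum>x\<in>X. w x js) A i = (\<Sum>x\<in>X. signed_votes m (w x) A i)"
  unfolding signed_votes_def sum_distrib_right by (rule sum.swap)

lemma signed_votes_ranking:
  assumes "xs \<in> permutations_of_set {1..m}"
  shows "signed_votes m (\<lambda>js. of_bool (js = xs)) A i = of_bool (find (\<lambda>x. x \<in> A) xs = Some i)"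
proof -
  have "signed_votes m (\<lambda>js. of_bool (js = xs)) A i =
      (\<Sum>js\<in>permutations_of_set {1..m}.
        if js = xs then of_bool (find (\<lambda>x. x \<in> A) xs = Some i) else 0)"
    unfolding signed_votes_def by (intro sum.cong refl) simp
  then show ?thesis
    using assms by simp
qed

text \<open>Each ranking gives its whole weight to exactly one member of \<open>A\<close>. This
  serves both the divisibility claim and the computation of the total in the existence
  proof.\<close>

lemma sum_signed_votes:
  assumes "A \<subseteq> {1..m}" "A \<noteq> {}"
  shows "(\<Sum>i\<in>A. signed_votes m w A i) = (\<Sum>js\<in>permutations_of_set {1..m}. w js)"
proof -
  have fin: "finite A"
    using assms(1) finite_subset by blast
  have one: "(\<Sum>i\<in>A. of_bool (find (\<lambda>x. x \<in> A) js = Some i)) = (1::int)"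
    if "js \<in> permutations_of_set {1..m}" for js
  proof -
    have "find (\<lambda>x. x \<in> A) js \<noteq> None"
      using assms that by (auto simp: find_None_iff permutations_of_set_def)
    then obtain k where k: "find (\<lambda>x. x \<in> A) js = Some k"
      by blast
    then have "k \<in> A"
      by (auto simp: find_Some_iff)
    then show ?thesis
      using fin by (simp add: k of_bool_def)
  qed
  have "(\<Sum>i\<in>A. signed_votes m w A i) =
      (\<Sum>js\<in>permutations_of_set {1..m}. w js * (\<Sum>i\<in>A. of_bool (find (\<lambda>x. x \<in> A) js = Some i)))"
    unfolding signed_votes_def sum_distrib_left by (rule sum.swap)
  also have "\<dots> = (\<Sum>js\<in>permutations_of_set {1..m}. w js)"
    using one by (intro sum.cong) simp_all
  finally show ?thesis .
qed

lemma total_eq_sum_votes: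
  assumes "A \<subseteq> {1..m}" "A \<noteq> {}"
  shows "total_voters m N = (\<Sum>i\<in>A. votes m N A i)"
proof -
  have "int (total_voters m N) = (\<Sum>i\<in>A. signed_votes m (\<lambda>js. int (N js)) A i)"
    using assms by (simp add: sum_signed_votes total_voters_def)
  also have "\<dots> = int (\<Sum>i\<in>A. votes m N A i)"
    using assms by (simp add: votes_eq_signed_votes)
  finally show ?thesis
    by linarith
qed

text \<open>Exchanging the names \<open>i\<close> and \<open>j\<close> permutes the rankings and
  maps those voting for \<open>i\<close> in \<open>A\<close> to those voting for \<open>j\<close>; a
  constant weight does not see the exchange.\<close>

lemma signed_votes_uniform:
  assumes "A \<subseteq> {1..m}" "i \<in> A" "j \<in> A"
  shows "signed_votes m (\<lambda>_. c) A i = signed_votes m (\<lambda>_. c) A j"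
proof -
  let ?t = "Transposition.transpose i j"
  have tA: "?t x \<in> A \<longleftrightarrow> x \<in> A" for x
    using assms by (auto simp: Transposition.transpose_def)
  have tm: "?t ` {1..m} = {1..m}"
    using assms by (intro transpose_image_eq) auto
  have perm: "map ?t js \<in> permutations_of_set {1..m}" if "js \<in> permutations_of_set {1..m}" for js
    using that tm by (auto simp: permutations_of_set_def distinct_map inj_on_def
        dest: injD[OF inj_transpose])
  have invol: "map ?t (map ?t js) = js" for js :: "nat list"
    by (simp add: transpose_comp_involutory)
  have find_map: "find (\<lambda>x. x \<in> A) (map ?t js) = map_option ?t (find (\<lambda>x. x \<in> A) js)" for js
    by (induction js) (simp_all add: tA)
  have "(find (\<lambda>x. x \<in> A) (map ?t js) = Some j) = (find (\<lambda>x. x \<in> A) js = Some i)" for js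
    unfolding find_map by (cases "find (\<lambda>x. x \<in> A) js")
      (auto simp: transpose_eq_iff)
  then show ?thesis
    unfolding signed_votes_def
    by (intro sum.reindex_bij_witness[of _ "map ?t" "map ?t"]) (simp_all only: perm invol)
qed

section \<open>Profiles acting on a single election\<close>

text \<open>If \<open>C\<close> meets \<open>zs\<close>, both rankings cast the same vote there; if
  \<open>C\<close> misses \<open>a\<close> or \<open>b\<close>, their order is invisible. In both
  cases the difference cancels. The set \<open>C\<close> is arbitrary, hence the intersection with
  \<open>{1..m}\<close>: other elements occur in no ranking.\<close>

lemma signed_votes_exchange:
  assumes "A \<subseteq> {1..m}" "a \<in> A" "b \<in> A" "a \<noteq> b"
  shows "\<exists>v. \<forall>C i. signed_votes m v C i =
    of_bool (C \<inter> {1..m} \<subseteq> A \<and> a \<in> C \<and> b \<in> C) * (of_bool (i = a) - of_bool (i = b))"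
proof -
  define zs where "zs = sorted_list_of_set ({1..m} - A)"
  define ys where "ys = sorted_list_of_set (A - {a, b})"
  define v :: "nat list \<Rightarrow> int"
    where "v js = of_bool (js = zs @ a # b # ys) - of_bool (js = zs @ b # a # ys)" for js
  have "finite A"
    using assms(1) finite_subset by blast
  then have sets: "set zs = {1..m} - A" "set ys = A - {a, b}" "distinct zs" "distinct ys"
    by (simp_all add: zs_def ys_def)
  have perms: "zs @ a # b # ys \<in> permutations_of_set {1..m}"
      "zs @ b # a # ys \<in> permutations_of_set {1..m}"
    using assms sets by (auto simp: permutations_of_set_def)
  have find_append: "find P (xs @ xs') = (case find P xs of None \<Rightarrow> find P xs' | Some x \<Rightarrow> Some x)"
    for P and xs xs' :: "nat list"
    by (induction xs) auto
  have "signed_votes m v C i =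
      of_bool (C \<inter> {1..m} \<subseteq> A \<and> a \<in> C \<and> b \<in> C) * (of_bool (i = a) - of_bool (i = b))" for C i
  proof -
    have none: "find (\<lambda>x. x \<in> C) zs = None \<longleftrightarrow> C \<inter> {1..m} \<subseteq> A"
      by (auto simp: find_None_iff sets)
    have diff: "signed_votes m v C i = of_bool (find (\<lambda>x. x \<in> C) (zs @ a # b # ys) = Some i)
        - of_bool (find (\<lambda>x. x \<in> C) (zs @ b # a # ys) = Some i)"
      unfolding v_def signed_votes_diff signed_votes_ranking[OF perms(1)]
        signed_votes_ranking[OF perms(2)] ..
    show ?thesis
    proof (cases "find (\<lambda>x. x \<in> C) zs")
      case None
      with none have "C \<inter> {1..m} \<subseteq> A"
        by blast
      then show ?thesis
        by (simp add: diff find_append None eq_commute[of _ i])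
    next
      case (Some x)
      with none have "\<not> C \<inter> {1..m} \<subseteq> A"
        by simp
      then show ?thesis
        by (simp add: diff find_append Some)
    qed
  qed
  then show ?thesis
    by blast
qed

lemma signed_votes_elementary:
  assumes "A \<subseteq> {1..m}" "a \<in> A" "b \<in> A" "a \<noteq> b"
  shows "\<exists>v. \<forall>C i. C \<subseteq> {1..m} \<longrightarrow>
    signed_votes m v C i = of_bool (C = A) * (of_bool (i = a) - of_bool (i = b))"
proof -
  have "finite A"
    using assms(1) finite_subset by blast
  then show ?thesis
    using assms
  proof (induction A rule: finite_psubset_induct)
    case (psubset A)
    define S where "S = {B. B \<subset> A \<and> a \<in> B \<and> b \<in> B}"
    have finS: "finite S"
      using psubset.hyps by (auto simp: S_def intro: finite_subset[of _ "Pow A"])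
    define P where "P B v \<longleftrightarrow> (\<forall>C i. C \<subseteq> {1..m} \<longrightarrow>
        signed_votes m v C i = of_bool (C = B) * (of_bool (i = a) - of_bool (i = b)))" for B v
    have "\<exists>v. P B v" if "B \<in> S" for B
      unfolding P_def
    proof (rule psubset.IH)
      show "B \<subset> A" "B \<subseteq> {1..m}" "a \<in> B" "b \<in> B" "a \<noteq> b"
        using that psubset.prems by (auto simp: S_def)
    qed
    then obtain v where "\<And>B. B \<in> S \<Longrightarrow> P B (v B)"
      by metis
    then have v: "signed_votes m (v B) C i = of_bool (C = B) * (of_bool (i = a) - of_bool (i = b))"
      if "B \<in> S" "C \<subseteq> {1..m}" for B C i
      using that unfolding P_def by blast
    obtain u where u: "\<And>C i. signed_votes m u C i =
        of_bool (C \<inter> {1..m} \<subseteq> A \<and> a \<in> C \<and> b \<in> C) * (of_bool (i = a) - of_bool (i = b))"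
      using signed_votes_exchange[OF psubset.prems] by blast
    have "signed_votes m (\<lambda>js. u js - (\<Sum>B\<in>S. v B js)) C i =
        of_bool (C = A) * (of_bool (i = a) - of_bool (i = b))" if C: "C \<subseteq> {1..m}" for C i
    proof -
      have "(\<Sum>B\<in>S. signed_votes m (v B) C i) =
          (\<Sum>B\<in>S. of_bool (C = B)) * (of_bool (i = a) - of_bool (i = b))"
        unfolding sum_distrib_right by (intro sum.cong refl v C)
      also have "(\<Sum>B\<in>S. of_bool (C = B)) = (of_bool (C \<in> S) :: int)"
        using finS by (simp add: of_bool_def)
      finally have "signed_votes m (\<lambda>js. u js - (\<Sum>B\<in>S. v B js)) C i =
          (of_bool (C \<subseteq> A \<and> a \<in> C \<and> b \<in> C) - of_bool (C \<in> S)) *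
          (of_bool (i = a) - of_bool (i = b))"
        using C by (simp add: signed_votes_diff signed_votes_sum u Int_absorb2 left_diff_distrib)
      \<comment> \<open>Among the subsets of \<open>A\<close> containing \<open>a\<close> and
        \<open>b\<close>, only \<open>A\<close> itself is missing from \<open>S\<close>.\<close>
      also have "of_bool (C \<subseteq> A \<and> a \<in> C \<and> b \<in> C) - of_bool (C \<in> S) = (of_bool (C = A) :: int)"
        using psubset.prems by (auto simp: S_def)
      finally show ?thesis .
    qed
    then show ?case
      by blast
  qed
qed

section \<open>Adding uniform profiles, and divisibility of the total\<close>

lemma q_concordant_iff_signed:
  "q_concordant m \<sigma> N \<longleftrightarrow>
    (\<forall>A i j. A \<subseteq> {1..m} \<and> i \<in> A \<and> j \<in> A \<and> i \<noteq> j \<longrightarrow>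
      (let n = signed_votes m (\<lambda>js. int (N js)) A
       in (\<sigma> A i < \<sigma> A j \<longleftrightarrow> n i > n j) \<and> (\<sigma> A i = \<sigma> A j \<longleftrightarrow> n i = n j)))"
  unfolding q_concordant_def Let_def
  by (intro iff_allI imp_cong refl) (simp flip: votes_eq_signed_votes)

lemma q_concordant_add_uniform:
  assumes "q_concordant m \<sigma> N"
  shows "q_concordant m \<sigma> (\<lambda>js. N js + 1)"
  unfolding q_concordant_iff_signed Let_def
proof (intro allI impI)
  fix A i j assume A: "A \<subseteq> {1..m} \<and> i \<in> A \<and> j \<in> A \<and> i \<noteq> j"
  then have "signed_votes m (\<lambda>_. 1) A i = signed_votes m (\<lambda>_. 1) A j"
    by (intro signed_votes_uniform) auto
  moreover have "signed_votes m (\<lambda>js. int (N js + 1)) A k =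
      signed_votes m (\<lambda>js. int (N js)) A k + signed_votes m (\<lambda>_. 1) A k" for k
    by (simp add: signed_votes_add)
  ultimately show "(\<sigma> A i < \<sigma> A j \<longleftrightarrow>
      signed_votes m (\<lambda>js. int (N js + 1)) A i > signed_votes m (\<lambda>js. int (N js + 1)) A j) \<and>
    (\<sigma> A i = \<sigma> A j \<longleftrightarrow>
      signed_votes m (\<lambda>js. int (N js + 1)) A i = signed_votes m (\<lambda>js. int (N js + 1)) A j)"
    using assms A unfolding q_concordant_iff_signed Let_def by simp
qed

lemma Theta_add_fact:
  assumes "\<theta> \<in> Theta m"
  shows "\<theta> + fact m \<in> Theta m"
proof -
  have "\<exists>N. voting_situation m N \<and> q_concordant m \<sigma> N \<and> total_voters m N = \<theta> + fact m"
    if \<sigma>: "ranking_pattern m \<sigma>" for \<sigma>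
  proof -
    obtain N where N: "q_concordant m \<sigma> N" "total_voters m N = \<theta>"
      using assms \<sigma> by (auto simp: Theta_def)
    have "total_voters m (\<lambda>js. N js + 1) = \<theta> + fact m"
      using N(2) by (simp add: total_voters_def sum.distrib sum_Suc)
    then show ?thesis
      using q_concordant_add_uniform[OF N(1)] by (auto simp: voting_situation_def intro!: exI)
  qed
  then show ?thesis
    using assms by (simp add: Theta_def)
qed

text \<open>When all candidates tie, the election \<open>{1..k}\<close> splits the total into
  \<open>k\<close> equal parts, for each \<open>k\<close> in \<open>{2..m}\<close>.\<close>

lemma Lcm_dvd_Theta:
  assumes "\<theta> \<in> Theta m"
  shows "Lcm {2..m} dvd \<theta>"
proof (rule Lcm_least)
  fix k assume k: "k \<in> {2..m}"
  \<comment> \<open>With all ranks 1, the set of better ranked candidates is empty, as no rank is at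
    most 0.\<close>
  have "ranking_pattern m (\<lambda>_ _. 1)"
    by (auto simp: ranking_pattern_def ranking_function_def)
  then obtain N where N: "q_concordant m (\<lambda>_ _. 1) N" "total_voters m N = \<theta>"
    using assms unfolding Theta_def by blast
  have sub: "{1..k} \<subseteq> {1..m}"
    using k by auto
  have tie: "votes m N {1..k} i = votes m N {1..k} 1" if "i \<in> {1..k}" for i
  proof (cases "i = 1")
    case False
    then show ?thesis
      using N(1)[unfolded q_concordant_def, rule_format, of "{1..k}" i 1] that k sub by simp
  qed simp
  have "\<theta> = (\<Sum>i\<in>{1..k}. votes m N {1..k} i)"
    using total_eq_sum_votes[OF sub, of N] N(2) k by simp
  also have "\<dots> = (\<Sum>i\<in>{1..k}. votes m N {1..k} 1)"
    by (intro sum.cong refl tie)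
  finally show "k dvd \<theta>"
    by simp
qed

section \<open>Realising all patterns with one common total\<close>

text \<open>The prescribed count is the sum of \<sigma>(C,j) - \<sigma>(C,i) over \<open>j\<close>
  in \<open>C\<close>, so two candidates differ by \<open>card C\<close> times their rank
  difference, with the better ranked one ahead. The bound \<open>K\<close> is chosen before the
  pattern so that one total can serve all patterns.\<close>

lemma ranking_pattern_signed_profile:
  "\<exists>K::int. K \<ge> 0 \<and> (\<forall>\<sigma>. ranking_pattern m \<sigma> \<longrightarrow> (\<exists>w.
      (\<forall>js\<in>permutations_of_set {1..m}. \<bar>w js\<bar> \<le> K) \<and>
      (\<forall>C i. C \<subseteq> {1..m} \<and> i \<in> C \<longrightarrow>
        signed_votes m w C i =
          of_bool (card C \<ge> 2) * ((\<Sum>j\<in>C. int (\<sigma> C j)) - int (card C) * int (\<sigma> C i)))))"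
proof -
  define T where "T = (SIGMA A:{A. A \<subseteq> {1..m} \<and> card A \<ge> 2}. {(a, b). a \<in> A \<and> b \<in> A \<and> a \<noteq> b})"
  have finA: "finite A" if "A \<subseteq> {1..m}" for A
    using that finite_subset by blast
  have finP: "finite {(a, b). a \<in> A \<and> b \<in> A \<and> a \<noteq> b}" if "A \<subseteq> {1..m}" for A
    using finA[OF that] by (auto intro: finite_subset[of _ "A \<times> A"])
  have finT: "finite T"
    unfolding T_def using finP by (intro finite_SigmaI) auto
  define P where "P A a b v \<longleftrightarrow> (\<forall>C i. C \<subseteq> {1..m} \<longrightarrow>
      signed_votes m v C i = of_bool (C = A) * (of_bool (i = a) - of_bool (i = b)))" for A a b v
  have "\<exists>v. P A a b v" if "(A, a, b) \<in> T" for A a b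
    unfolding P_def using that by (intro signed_votes_elementary) (auto simp: T_def)
  then obtain v where "\<And>A a b. (A, a, b) \<in> T \<Longrightarrow> P A a b (v A a b)"
    by metis
  then have v: "signed_votes m (v A a b) C i = of_bool (C = A) * (of_bool (i = a) - of_bool (i = b))"
    if "(A, a, b) \<in> T" "C \<subseteq> {1..m}" for A a b C i
    using that unfolding P_def by blast
  \<comment> \<open>Ranks are at most \<open>m\<close>; summing over all rankings as well gives one
    bound for every \<open>js\<close>.\<close>
  define K where "K = (\<Sum>js\<in>permutations_of_set {1..m}. \<Sum>(A, a, b)\<in>T. int m * \<bar>v A a b js\<bar>)"
  have "K \<ge> 0"
    unfolding K_def by (intro sum_nonneg) auto
  moreover have "\<exists>w. (\<forall>js\<in>permutations_of_set {1..m}. \<bar>w js\<bar> \<le> K) \<and>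
      (\<forall>C i. C \<subseteq> {1..m} \<and> i \<in> C \<longrightarrow> signed_votes m w C i =
        of_bool (card C \<ge> 2) * ((\<Sum>j\<in>C. int (\<sigma> C j)) - int (card C) * int (\<sigma> C i)))"
    if \<sigma>: "ranking_pattern m \<sigma>" for \<sigma>
  proof -
    \<comment> \<open>Each candidate \<open>b\<close> hands as many votes as its rank to every
      rival, so a worse rank costs more votes.\<close>
    define w where "w js = (\<Sum>(A, a, b)\<in>T. int (\<sigma> A b) * v A a b js)" for js
    have \<sigma>_le: "\<sigma> A b \<le> m" if "(A, a, b) \<in> T" for A a b
    proof -
      have "\<sigma> A b \<le> card A"
        using that \<sigma> by (auto simp: T_def ranking_pattern_def ranking_function_def)
      also have "\<dots> \<le> m"
        using that card_mono[of "{1..m}" A] by (simp add: T_def)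
      finally show ?thesis .
    qed
    have bound: "\<bar>w js\<bar> \<le> K" if js: "js \<in> permutations_of_set {1..m}" for js
    proof -
      have "\<bar>w js\<bar> \<le> (\<Sum>(A, a, b)\<in>T. int m * \<bar>v A a b js\<bar>)"
        unfolding w_def
        by (rule order.trans[OF sum_abs sum_mono])
          (auto simp: abs_mult intro!: mult_right_mono \<sigma>_le)
      also have "\<dots> \<le> K"
        unfolding K_def
        by (rule member_le_sum[OF js]) (auto intro!: sum_nonneg)
      finally show ?thesis .
    qed
    have eq: "signed_votes m w C i =
        of_bool (card C \<ge> 2) * ((\<Sum>j\<in>C. int (\<sigma> C j)) - int (card C) * int (\<sigma> C i))"
      if C: "C \<subseteq> {1..m}" "i \<in> C" for C i
    proof -
      let ?g = "\<lambda>a b. int (\<sigma> C b) * (of_bool (i = a) - of_bool (i = b))"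
      have "signed_votes m w C i = (\<Sum>(A, a, b)\<in>T. of_bool (C = A) * ?g a b)"
        unfolding w_def signed_votes_sum case_prod_beta
        by (intro sum.cong refl) (auto simp: signed_votes_scale v[OF _ C(1)])
      also have "\<dots> = (\<Sum>A | A \<subseteq> {1..m} \<and> card A \<ge> 2. of_bool (C = A) *
          (\<Sum>(a, b) | a \<in> A \<and> b \<in> A \<and> a \<noteq> b. ?g a b))"
        unfolding T_def sum_distrib_left
        by (subst sum.Sigma) (auto simp: finP case_prod_beta intro!: sum.cong)
      also have "\<dots> = (\<Sum>A | A \<subseteq> {1..m} \<and> card A \<ge> 2. if C = A
          then \<Sum>(a, b) | a \<in> A \<and> b \<in> A \<and> a \<noteq> b. ?g a b else 0)"
        by (intro sum.cong refl) simp
      also have "\<dots> = of_bool (card C \<ge> 2) * (\<Sum>(a, b) | a \<in> C \<and> b \<in> C \<and> a \<noteq> b. ?g a b)"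
        using C(1) by simp
      \<comment> \<open>The diagonal terms vanish, so adding them gives a full double sum.\<close>
      also have "(\<Sum>(a, b) | a \<in> C \<and> b \<in> C \<and> a \<noteq> b. ?g a b) = (\<Sum>(a, b)\<in>C \<times> C. ?g a b)"
        using finA[OF C(1)] by (intro sum.mono_neutral_left) auto
      also have "\<dots> = (\<Sum>a\<in>C. \<Sum>b\<in>C. ?g a b)"
        by (simp add: sum.cartesian_product)
      also have "\<dots> = (\<Sum>j\<in>C. int (\<sigma> C j)) - int (card C) * int (\<sigma> C i)"
      proof -
        have "(\<Sum>a\<in>C. \<Sum>b\<in>C. int (\<sigma> C b) * of_bool (i = a)) = (\<Sum>j\<in>C. int (\<sigma> C j))"
          using finA[OF C(1)] C(2)
          by (simp add: of_bool_def flip: sum_distrib_right sum_distrib_left)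
        moreover have "(\<Sum>b\<in>C. int (\<sigma> C b) * of_bool (i = b)) = int (\<sigma> C i)"
          using finA[OF C(1)] C(2) by (simp add: of_bool_def if_distrib cong: if_cong)
        ultimately show ?thesis
          by (simp add: right_diff_distrib sum_subtractf)
      qed
      finally show ?thesis .
    qed
    show ?thesis
      using bound eq by blast
  qed
  ultimately show ?thesis
    by blast
qed

lemma Theta_nonempty:
  assumes "m \<ge> 1"
  shows "Theta m \<noteq> {}"
proof -
  obtain K :: int where K: "K \<ge> 0" and
    profile: "\<And>\<sigma>. ranking_pattern m \<sigma> \<Longrightarrow> \<exists>w.
      (\<forall>js\<in>permutations_of_set {1..m}. \<bar>w js\<bar> \<le> K) \<and>
      (\<forall>C i. C \<subseteq> {1..m} \<and> i \<in> C \<longrightarrow>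
        signed_votes m w C i =
          of_bool (card C \<ge> 2) * ((\<Sum>j\<in>C. int (\<sigma> C j)) - int (card C) * int (\<sigma> C i)))"
    using ranking_pattern_signed_profile[of m] by blast
  \<comment> \<open>\<open>K + 1\<close> voters per ranking: this absorbs corrections down to
    \<open>-K\<close> and keeps the total positive even if \<open>K\<close> is 0.\<close>
  define \<theta> where "\<theta> = nat (K + 1) * fact m"
  have pos: "\<theta> > 0"
    using K by (simp add: \<theta>_def)
  have "\<exists>N. voting_situation m N \<and> q_concordant m \<sigma> N \<and> total_voters m N = \<theta>"
    if \<sigma>: "ranking_pattern m \<sigma>" for \<sigma>
  proof -
    obtain w where bound: "\<forall>js\<in>permutations_of_set {1..m}. \<bar>w js\<bar> \<le> K"
      and w': "\<forall>C i. C \<subseteq> {1..m} \<and> i \<in> C \<longrightarrow> signed_votes m w C i =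
        of_bool (card C \<ge> 2) * ((\<Sum>j\<in>C. int (\<sigma> C j)) - int (card C) * int (\<sigma> C i))"
      using profile[OF \<sigma>] by blast
    have w: "signed_votes m w C i =
        of_bool (card C \<ge> 2) * ((\<Sum>j\<in>C. int (\<sigma> C j)) - int (card C) * int (\<sigma> C i))"
      if "C \<subseteq> {1..m}" "i \<in> C" for C i
      using w' that by blast
    \<comment> \<open>On rankings the argument of \<open>nat\<close> is at least 1, so nothing is
      truncated.\<close>
    define N where "N js = nat (K + 1 + w js)" for js
    have N: "int (N js) = w js + (K + 1)" if "js \<in> permutations_of_set {1..m}" for js
      using bspec[OF bound that] by (simp add: N_def)
    have nv: "signed_votes m (\<lambda>js. int (N js)) A i =
        signed_votes m w A i + signed_votes m (\<lambda>_. K + 1) A i" for A i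
      unfolding signed_votes_add[symmetric] by (simp add: signed_votes_def N)
    \<comment> \<open>In the one-candidate election \<open>{1}\<close> every ranking votes for 1,
      and there the prescribed count of \<open>w\<close> is 0.\<close>
    have "(\<Sum>js\<in>permutations_of_set {1..m}. w js) = 0"
      using sum_signed_votes[of "{1}" m w] w[of "{1}" 1] assms by simp
    then have "int (total_voters m N) = int \<theta>"
      using K by (simp add: total_voters_def N sum.distrib \<theta>_def of_nat_diff algebra_simps)
    then have tot: "total_voters m N = \<theta>"
      by simp
    have "q_concordant m \<sigma> N"
      unfolding q_concordant_iff_signed Let_def
    proof (intro allI impI)
      fix A i j assume A: "A \<subseteq> {1..m} \<and> i \<in> A \<and> j \<in> A \<and> i \<noteq> j"
      then have "finite A"
        using finite_subset by blast
      then have card: "card A \<ge> 2"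
        using A card_mono[of A "{i, j}"] by simp
      have unif: "signed_votes m (\<lambda>_. K + 1) A i = signed_votes m (\<lambda>_. K + 1) A j"
        using A by (intro signed_votes_uniform) auto
      \<comment> \<open>The uniform part and the sum of ranks are common to \<open>i\<close> and
        \<open>j\<close> and cancel. The rank difference appears reversed, as concordance
        demands.\<close>
      have "signed_votes m (\<lambda>js. int (N js)) A i - signed_votes m (\<lambda>js. int (N js)) A j =
          int (card A) * (int (\<sigma> A j) - int (\<sigma> A i))"
        using A card unif by (simp add: nv w algebra_simps)
      moreover have "int (card A) > 0"
        using card by simp
      ultimately show "(\<sigma> A i < \<sigma> A j \<longleftrightarrow>
          signed_votes m (\<lambda>js. int (N js)) A i > signed_votes m (\<lambda>js. int (N js)) A j) \<and>
        (\<sigma> A i = \<sigma> A j \<longleftrightarrow>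
          signed_votes m (\<lambda>js. int (N js)) A i = signed_votes m (\<lambda>js. int (N js)) A j)"
        using zero_less_mult_iff[of "int (card A)" "int (\<sigma> A j) - int (\<sigma> A i)"]
          mult_eq_0_iff[of "int (card A)" "int (\<sigma> A j) - int (\<sigma> A i)"]
        by linarith
    qed
    then show ?thesis
      using tot pos by (auto simp: voting_situation_def)
  qed
  then have "\<theta> \<in> Theta m"
    using pos by (simp add: Theta_def)
  then show ?thesis
    by blast
qed

theorem theorem3:
  fixes m :: nat
  assumes "m \<ge> 2"
  shows "Theta m \<noteq> {} \<and>
         (\<forall>\<theta>\<in>Theta m. Lcm {2..m} dvd \<theta>) \<and>
         (\<forall>\<theta>\<in>Theta m. \<theta> + fact m \<in> Theta m)"
  using assms Theta_nonempty Lcm_dvd_Theta Theta_add_fact by simp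

end
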